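(* Let $a\in\mathbb Z_N^\times$ satisfy $a^2\equiv1\pmod N$. Let $S\subset\mathbb Z_N$ be nonempty and assume $$S=-aS,\qquad S\cap(1-a)\mathbb Z_N=\emptyset.$$ Define $f:\mathbb Z_N\times\mathbb Z_N\to\{0,1\}$ by $f(x,y)=1$ if $y-ax\in S$ and $f(x,y)=0$ otherwise. Then $f$ is the edge indicator of a simple undirected graph $G$ on $\mathbb Z_N$. If $s=|E(G)|$, then $$\operatorname{FR}_{\min}(G)=\frac{\mathcal E(G)}{\sqrt{2s}}.$$
   Context: $\mathbb Z_N=\mathbb Z/N\mathbb Z$, and $-aS=\{-at:t\in S\}$. That $f$ is the edge indicator of $G$ means that vertices $x,y\in\mathbb Z_N$ are adjacent in $G$ if and only if $f(x,y)=1$. A vertex labeling of a graph $G=(V,E)$ of order $N=|V|$ is a bijection $\sigma:V\to\mathbb Z_N$. The adjacency matrix under $\sigma$ is the $N\times N$ matrix $A_\sigma$, indexed by $\mathbb Z_N\times\mathbb Z_N$, with $(A_\sigma)_{x,y}=1$ if the vertices labeled $x$ and $y$ are adjacent and $0$ otherwise. $F$ is the unitary Fourier matrix $F_{mx}=\frac1{\sqrt N}e^{-2\pi i mx/N}$. The Fourier ratio of a nonzero $N\times N$ matrix $M$ is $\operatorname{FR}(M)=\|FMF\|_1/\|FMF\|_2$, where $\|\cdot\|_1$ is the entrywise $\ell^1$-norm and $\|\cdot\|_2$ the Frobenius norm. The edge complexity is $\operatorname{FR}_{\min}(G)=\min_\sigma\operatorname{FR}(A_\sigma)$, the minimum over all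 vertex labelings. The graph energy $\mathcal E(G)$ is the sum of the absolute values of the adjacency eigenvalues counted with multiplicity. *)

theory Defs
  imports
    "HOL-Number_Theory.Cong"
    "Jordan_Normal_Form.Spectral_Radius"
begin

text \<open>\<open>\<int>/N\<int>\<close> is represented by its least nonnegative residues.\<close>

definition ZMod :: "nat \<Rightarrow> int set" where
  "ZMod N = {0..<int N}"

text \<open>A simple undirected graph is a finite vertex set with a set of two-element
  subsets of it as edges.\<close>

type_synonym 'v graph = "'v set \<times> 'v set set"

abbreviation verts :: "'v graph \<Rightarrow> 'v set" where "verts G \<equiv> fst G"

abbreviation edges :: "'v graph \<Rightarrow> 'v set set" where "edges G \<equiv> snd G"

definition simple_graph :: "'v graph \<Rightarrow> bool" where
  "simple_graph G \<longleftrightarrow>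
     finite (verts G) \<and> edges G \<subseteq> {{u, v} |u v. u \<in> verts G \<and> v \<in> verts G \<and> u \<noteq> v}"

definition adjacent :: "'v graph \<Rightarrow> 'v \<Rightarrow> 'v \<Rightarrow> bool" where
  "adjacent G u v \<longleftrightarrow> {u, v} \<in> edges G"

definition edge_indicator :: "('v \<Rightarrow> 'v \<Rightarrow> nat) \<Rightarrow> 'v graph \<Rightarrow> bool" where
  "edge_indicator f G \<longleftrightarrow> (\<forall>x\<in>verts G. \<forall>y\<in>verts G. adjacent G x y \<longleftrightarrow> f x y = 1)"

text \<open>Labelings are extensional functions (arbitrary but fixed value outside the vertex
  set), so that each bijection is counted once and there are finitely many of them.\<close>

definition labelings :: "'v graph \<Rightarrow> ('v \<Rightarrow> int) set" where
  "labelings G = {\<sigma> \<in> extensional (verts G). bij_betw \<sigma> (verts G) (ZMod (card (verts G)))}"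

definition adj_mat :: "'v graph \<Rightarrow> ('v \<Rightarrow> int) \<Rightarrow> complex mat" where
  "adj_mat G \<sigma> = (let N = card (verts G) in
     mat N N (\<lambda>(x, y). if adjacent G (inv_into (verts G) \<sigma> (int x)) (inv_into (verts G) \<sigma> (int y))
                        then 1 else 0))"

definition fourier_mat :: "nat \<Rightarrow> complex mat" where
  "fourier_mat N = mat N N (\<lambda>(m, x).
     1 / of_real (sqrt (real N)) *
     exp (- 2 * of_real pi * \<i> * of_nat m * of_nat x / of_nat N))"

definition l1_norm :: "complex mat \<Rightarrow> real" where
  "l1_norm M = (\<Sum>i<dim_row M. \<Sum>j<dim_col M. cmod (M $$ (i, j)))"

definition frobenius_norm :: "complex mat \<Rightarrow> real" where
  "frobenius_norm M = sqrt (\<Sum>i<dim_row M. \<Sum>j<dim_col M. (cmod (M $$ (i, j)))\<^sup>2)"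

text \<open>Only meaningful for nonzero square matrices; the value is 0 for the zero matrix.
  The outer factors are both \<open>F\<close>; there is no adjoint.\<close>

definition fourier_ratio :: "complex mat \<Rightarrow> real" where
  "fourier_ratio M = (let F = fourier_mat (dim_row M) in
     l1_norm (F * M * F) / frobenius_norm (F * M * F))"

definition edge_complexity :: "'v graph \<Rightarrow> real" where
  "edge_complexity G = Min ((\<lambda>\<sigma>. fourier_ratio (adj_mat G \<sigma>)) ` labelings G)"

text \<open>\<open>order \<mu> (char_poly A)\<close> is the algebraic multiplicity of the eigenvalue \<open>\<mu>\<close>.\<close>

definition mat_energy :: "complex mat \<Rightarrow> real" where
  "mat_energy A = (\<Sum>\<mu>\<in>spectrum A. real (order \<mu> (char_poly A)) * cmod \<mu>)"

text \<open>The labeling is immaterial, see \<open>graph_energy_eq\<close> below.\<close>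

definition graph_energy :: "'v graph \<Rightarrow> real" where
  "graph_energy G = mat_energy (adj_mat G (SOME \<sigma>. \<sigma> \<in> labelings G))"

lemma finite_labelings: "finite (verts G) \<Longrightarrow> finite (labelings G)"
  by (rule finite_subset[OF _ finite_PiE[of "verts G" "\<lambda>_. ZMod (card (verts G))"]])
    (auto simp: labelings_def PiE_def ZMod_def bij_betw_def)

lemma labelings_nonempty:
  assumes "finite (verts G)"
  shows "labelings G \<noteq> {}"
proof -
  have "card (verts G) = card (ZMod (card (verts G)))" by (simp add: ZMod_def)
  then obtain h where "bij_betw h (verts G) (ZMod (card (verts G)))"
    using assms finite_same_card_bij[of "verts G" "ZMod (card (verts G))"] by (auto simp: ZMod_def)
  then have "restrict h (verts G) \<in> labelings G"
    by (simp add: labelings_def cong: bij_betw_cong)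
  then show ?thesis by blast
qed

lemma similar_mat_permuted:
  fixes A B :: "'a :: field mat"
  assumes A: "A \<in> carrier_mat n n" and B: "B \<in> carrier_mat n n"
    and p: "bij_betw p {..<n} {..<n}"
    and BA: "\<And>i j. i < n \<Longrightarrow> j < n \<Longrightarrow> B $$ (i, j) = A $$ (p i, p j)"
  shows "similar_mat B A"
proof -
  define P :: "'a mat" where "P = mat n n (\<lambda>(i, j). if p i = j then 1 else 0)"
  define Q :: "'a mat" where "Q = mat n n (\<lambda>(i, j). if i = p j then 1 else 0)"
  have [simp]: "P \<in> carrier_mat n n" "Q \<in> carrier_mat n n" by (auto simp: P_def Q_def)
  have pl: "p i < n" if "i < n" for i using p that by (auto simp: bij_betw_def)
  have inj: "p i = p j \<longleftrightarrow> i = j" if "i < n" "j < n" for i j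
    using p that by (auto simp: bij_betw_def inj_on_def)
  have PX: "(P * X) $$ (i, j) = X $$ (p i, j)" if "X \<in> carrier_mat n n" "i < n" "j < n"
    for X :: "'a mat" and i j
  proof -
    have "(P * X) $$ (i, j) = (\<Sum>k = 0..<n. (if p i = k then X $$ (k, j) else 0))"
      using that pl by (simp add: P_def scalar_prod_def if_distrib if_distribR cong: if_cong)
    then show ?thesis using pl[OF that(2)] by simp
  qed
  have XQ: "(X * Q) $$ (i, j) = X $$ (i, p j)" if "X \<in> carrier_mat n n" "i < n" "j < n"
    for X :: "'a mat" and i j
  proof -
    have "(X * Q) $$ (i, j) = (\<Sum>k = 0..<n. (if k = p j then X $$ (i, k) else 0))"
      using that pl by (simp add: Q_def scalar_prod_def if_distrib if_distribR cong: if_cong)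
    then show ?thesis using pl[OF that(3)] by simp
  qed
  have PQ: "P * Q = 1\<^sub>m n"
  proof (rule eq_matI)
    fix i j assume "i < dim_row (1\<^sub>m n :: 'a mat)" "j < dim_col (1\<^sub>m n :: 'a mat)"
    then have ij: "i < n" "j < n" by auto
    then have "(P * Q) $$ (i, j) = P $$ (i, p j)" by (intro XQ) auto
    then show "(P * Q) $$ (i, j) = 1\<^sub>m n $$ (i, j)" using ij pl by (simp add: P_def inj)
  qed (auto simp: P_def Q_def)
  have QP: "Q * P = 1\<^sub>m n"
    by (rule mat_mult_left_right_inverse[OF _ _ PQ]) auto
  have PAQ: "B = P * A * Q"
  proof (rule eq_matI)
    fix i j assume ij: "i < dim_row (P * A * Q)" "j < dim_col (P * A * Q)"
    then have ij: "i < n" "j < n" by (auto simp: P_def Q_def)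
    have "(P * A * Q) $$ (i, j) = (P * A) $$ (i, p j)" using A ij by (intro XQ mult_carrier_mat[of _ n n]) auto
    also have "\<dots> = A $$ (p i, p j)" using A ij pl by (intro PX)
    finally show "B $$ (i, j) = (P * A * Q) $$ (i, j)" using BA ij by simp
  qed (use B in \<open>auto simp: P_def Q_def\<close>)
  show ?thesis unfolding similar_mat_def
    by (intro exI[of _ P] exI[of _ Q] similar_mat_witI[OF PQ QP PAQ B A]) auto
qed

lemma graph_energy_eq:
  assumes \<sigma>: "\<sigma> \<in> labelings G"
  shows "graph_energy G = mat_energy (adj_mat G \<sigma>)"
proof -
  define \<tau> where "\<tau> = (SOME \<sigma>. \<sigma> \<in> labelings G)"
  have \<tau>: "\<tau> \<in> labelings G" unfolding \<tau>_def by (rule someI[of "\<lambda>\<sigma>. \<sigma> \<in> labelings G", OF \<sigma>])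
  define N where "N = card (verts G)"
  define p where "p = (\<lambda>i. nat (\<sigma> (inv_into (verts G) \<tau> (int i))))"
  have bs: "bij_betw \<sigma> (verts G) (ZMod N)" and bt: "bij_betw \<tau> (verts G) (ZMod N)"
    using \<sigma> \<tau> by (auto simp: labelings_def N_def)
  have b1: "bij_betw int {..<N} (ZMod N)"
    by (rule bij_betw_byWitness[where f' = nat]) (auto simp: ZMod_def)
  have b2: "bij_betw nat (ZMod N) {..<N}"
    by (rule bij_betw_byWitness[where f' = int]) (auto simp: ZMod_def)
  have "bij_betw (nat \<circ> (\<sigma> \<circ> (inv_into (verts G) \<tau> \<circ> int))) {..<N} {..<N}"
    by (intro bij_betw_trans[OF _ b2] bij_betw_trans[OF _ bs]
        bij_betw_trans[OF b1 bij_betw_inv_into[OF bt]])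
  then have p: "bij_betw p {..<N} {..<N}" by (simp add: p_def o_def)
  have key: "inv_into (verts G) \<sigma> (int (p i)) = inv_into (verts G) \<tau> (int i)" and pl: "p i < N"
    if "i < N" for i
  proof -
    have i: "inv_into (verts G) \<tau> (int i) \<in> verts G"
      using bij_betw_inv_into[OF bt] that by (auto simp: bij_betw_def ZMod_def)
    then have "\<sigma> (inv_into (verts G) \<tau> (int i)) \<in> ZMod N"
      using bs by (auto simp: bij_betw_def)
    then show "p i < N" "inv_into (verts G) \<sigma> (int (p i)) = inv_into (verts G) \<tau> (int i)"
      using bs i by (auto simp: p_def ZMod_def bij_betw_def)
  qed
  have "similar_mat (adj_mat G \<tau>) (adj_mat G \<sigma>)"
    by (rule similar_mat_permuted[OF _ _ p])
      (auto simp: adj_mat_def Let_def key pl simp flip: N_def)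
  then have cp: "char_poly (adj_mat G \<tau>) = char_poly (adj_mat G \<sigma>)" by (rule char_poly_similar)
  have "spectrum (adj_mat G \<tau>) = spectrum (adj_mat G \<sigma>)"
    using eigenvalue_root_char_poly[of "adj_mat G \<tau>" N] eigenvalue_root_char_poly[of "adj_mat G \<sigma>" N] cp
    by (auto simp: spectrum_def adj_mat_def Let_def simp flip: N_def)
  with cp show ?thesis by (simp add: graph_energy_def mat_energy_def flip: \<tau>_def)
qed

end

theory Submission
  imports Defs
begin

text \<open>
  Since \<open>F\<close> is unitary, \<open>F A F\<close> and the diagonalization \<open>D\<close> of the Hermitian matrix \<open>A\<close> arise from each
  other by multiplication with unitary matrices on both sides, and both have the Frobenius norm
  of \<open>A\<close>. Among all matrices \<open>P M Q\<close> with \<open>P\<close>, \<open>Q\<close> unitary, a monomial matrix \<open>M\<close> (one nonzero entry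
  at most per row and column) has the least entrywise \<open>\<ell>\<^sup>1\<close>-norm: some unitary \<open>V\<close> satisfies
  \<open>tr (V M) = \<parallel>M\<parallel>\<^sub>1\<close>, whereas \<open>|tr (W X)| \<le> \<parallel>X\<parallel>\<^sub>1\<close> for every unitary \<open>W\<close>, as its entries have
  modulus at most 1. Applied to \<open>D\<close> this bounds the Fourier ratio of every labeling from below by the
  energy quotient. In the identity labeling the adjacency matrix is invariant under
  \<open>(x, y) \<mapsto> (x + 1, y + a)\<close>, so \<open>(F A F)\<^sub>m\<^sub>n = 0\<close> unless \<open>m \<equiv> - a n\<close>; hence \<open>F A F\<close> is itself monomial
  and the bound is attained.
\<close>

subsection \<open>Unitary matrices and monomial matrices\<close>

lemma dim_mat_adjoint [simp]: "dim_row (mat_adjoint A) = dim_col A" "dim_col (mat_adjoint A) = dim_row A"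
  by (simp_all add: mat_adjoint_def)

lemma mat_adjoint_carrier [simp]: "A \<in> carrier_mat n m \<Longrightarrow> mat_adjoint A \<in> carrier_mat m n"
  by auto

lemma index_mat_adjoint [simp]:
  fixes A :: "complex mat"
  shows "i < dim_col A \<Longrightarrow> j < dim_row A \<Longrightarrow> mat_adjoint A $$ (i, j) = cnj (A $$ (j, i))"
  by (simp add: mat_adjoint_def mat_of_rows_index conjugate_complex_def)

lemma mat_adjoint_adjoint [simp]: "mat_adjoint (mat_adjoint A) = (A :: complex mat)"
  by (rule eq_matI) auto

lemma index_mult_mat_sum:
  assumes "A \<in> carrier_mat n k" "B \<in> carrier_mat k m" "i < n" "j < m"
  shows "(A * B) $$ (i, j) = (\<Sum>l<k. A $$ (i, l) * B $$ (l, j))"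
  using assms by (auto simp: scalar_prod_def atLeast0LessThan)

lemma mult_carrier_square [simp]:
  "A \<in> carrier_mat n n \<Longrightarrow> B \<in> carrier_mat n n \<Longrightarrow> A * B \<in> carrier_mat n n"
  by (rule mult_carrier_mat)

lemma mat_adjoint_mult:
  fixes A B :: "complex mat"
  assumes "A \<in> carrier_mat n k" "B \<in> carrier_mat k m"
  shows "mat_adjoint (A * B) = mat_adjoint B * mat_adjoint A"
proof (rule eq_matI)
  fix i j
  assume "i < dim_row (mat_adjoint B * mat_adjoint A)" "j < dim_col (mat_adjoint B * mat_adjoint A)"
  then have ij: "i < m" "j < n" using assms by auto
  then show "mat_adjoint (A * B) $$ (i, j) = (mat_adjoint B * mat_adjoint A) $$ (i, j)"
    using assms
    by (subst index_mult_mat_sum[of _ m k _ n])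
      (auto simp: scalar_prod_def atLeast0LessThan mult.commute intro!: sum.cong)
qed (use assms in auto)

text \<open>Only the left inverse is demanded; for square matrices \<open>unitary_right\<close>
  supplies the other side.\<close>

definition unitary_mats :: "nat \<Rightarrow> complex mat set" where
  "unitary_mats n = {U \<in> carrier_mat n n. mat_adjoint U * U = 1\<^sub>m n}"

lemma unitary_carrier: "U \<in> unitary_mats n \<Longrightarrow> U \<in> carrier_mat n n"
  by (simp add: unitary_mats_def)

lemma unitary_left: "U \<in> unitary_mats n \<Longrightarrow> mat_adjoint U * U = 1\<^sub>m n"
  by (simp add: unitary_mats_def)

lemma unitary_right: "U \<in> unitary_mats n \<Longrightarrow> U * mat_adjoint U = 1\<^sub>m n"
  by (rule mat_mult_left_right_inverse[of _ n]) (auto simp: unitary_mats_def)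

lemma unitary_adjoint: "U \<in> unitary_mats n \<Longrightarrow> mat_adjoint U \<in> unitary_mats n"
  using unitary_right[of U n] by (auto simp: unitary_mats_def)

lemma unitary_mult:
  assumes "U \<in> unitary_mats n" "V \<in> unitary_mats n"
  shows "U * V \<in> unitary_mats n"
proof -
  note c = unitary_carrier[OF assms(1)] unitary_carrier[OF assms(2)]
  have "mat_adjoint (U * V) * (U * V) = mat_adjoint V * (mat_adjoint U * U) * V"
    using c by (simp add: mat_adjoint_mult[of _ n n _ n] assoc_mult_mat[of _ n n _ n _ n])
  also have "\<dots> = 1\<^sub>m n"
    using c unitary_left assms by simp
  finally show ?thesis using c by (simp add: unitary_mats_def)
qed

text \<open>The columns of a unitary matrix are unit vectors, so no single entry can exceed 1 in
  modulus.\<close>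

lemma unitary_entry_le:
  assumes "U \<in> unitary_mats n" "i < n" "j < n"
  shows "cmod (U $$ (i, j)) \<le> 1"
proof -
  note c = unitary_carrier[OF assms(1)]
  have "complex_of_real (\<Sum>l<n. (cmod (U $$ (l, j)))\<^sup>2) = (\<Sum>l<n. cnj (U $$ (l, j)) * U $$ (l, j))"
    by (simp add: complex_norm_square mult.commute del: of_real_power)
  also have "\<dots> = (mat_adjoint U * U) $$ (j, j)"
    using c assms(3) by (subst index_mult_mat_sum[of _ n n _ n]) auto
  also have "\<dots> = 1" using unitary_left assms by simp
  finally have "(\<Sum>l<n. (cmod (U $$ (l, j)))\<^sup>2) = 1" using of_real_eq_1_iff by blast
  moreover have "(cmod (U $$ (i, j)))\<^sup>2 \<le> (\<Sum>l<n. (cmod (U $$ (l, j)))\<^sup>2)"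
    using assms(2) by (intro member_le_sum) auto
  ultimately show ?thesis
    using power_le_one_iff[of "cmod (U $$ (i, j))" 2] by simp
qed

section \<open>Traces and the entrywise l1-norm\<close>

definition mat_trace :: "'a :: comm_ring_1 mat \<Rightarrow> 'a" where
  "mat_trace A = (\<Sum>i<dim_row A. A $$ (i, i))"

lemma mat_trace_mult:
  assumes "A \<in> carrier_mat n m" "B \<in> carrier_mat m n"
  shows "mat_trace (A * B) = (\<Sum>i<n. \<Sum>k<m. A $$ (i, k) * B $$ (k, i))"
proof -
  have "mat_trace (A * B) = (\<Sum>i<n. (A * B) $$ (i, i))" using assms by (simp add: mat_trace_def)
  also have "\<dots> = (\<Sum>i<n. \<Sum>k<m. A $$ (i, k) * B $$ (k, i))"
    using assms by (intro sum.cong refl index_mult_mat_sum) auto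
  finally show ?thesis .
qed

lemma mat_trace_comm:
  assumes "A \<in> carrier_mat n m" "B \<in> carrier_mat m n"
  shows "mat_trace (A * B) = mat_trace (B * A)"
  unfolding mat_trace_mult[OF assms] mat_trace_mult[OF assms(2,1)]
  by (subst sum.swap) (simp add: mult.commute)

text \<open>Upper half of a duality: the trace is a sum in which each entry of \<open>M\<close>
  occurs once, with a weight of modulus at most 1.\<close>

lemma trace_unitary_le_l1_norm:
  assumes "V \<in> unitary_mats n" "M \<in> carrier_mat n n"
  shows "cmod (mat_trace (V * M)) \<le> l1_norm M"
proof -
  have "cmod (mat_trace (V * M)) \<le> (\<Sum>i<n. \<Sum>k<n. cmod (V $$ (i, k) * M $$ (k, i)))"
    unfolding mat_trace_mult[OF unitary_carrier[OF assms(1)] assms(2)]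
    by (intro order_trans[OF norm_sum] sum_mono norm_sum)
  also have "\<dots> \<le> (\<Sum>i<n. \<Sum>k<n. cmod (M $$ (k, i)))"
    using unitary_entry_le[OF assms(1)]
    by (intro sum_mono) (simp add: norm_mult mult_left_le_one_le)
  also have "\<dots> = l1_norm M"
    unfolding l1_norm_def using assms(2) by (subst sum.swap) simp
  finally show ?thesis .
qed

text \<open>\<open>p\<close> sends a column to the row of its only possibly nonzero entry. That
  entry may vanish too, and bijectivity of \<open>p\<close> is assumed separately.\<close>

definition monomial_mat :: "(nat \<Rightarrow> nat) \<Rightarrow> 'a :: zero mat \<Rightarrow> bool" where
  "monomial_mat p M \<longleftrightarrow> (\<forall>i<dim_row M. \<forall>j<dim_col M. i \<noteq> p j \<longrightarrow> M $$ (i, j) = 0)"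

lemma l1_norm_monomial:
  assumes M: "M \<in> carrier_mat n n" and p: "bij_betw p {..<n} {..<n}" and mon: "monomial_mat p M"
  shows "l1_norm M = (\<Sum>j<n. cmod (M $$ (p j, j)))"
proof -
  have "l1_norm M = (\<Sum>j<n. \<Sum>i<n. cmod (M $$ (i, j)))"
    using M by (subst sum.swap) (simp add: l1_norm_def)
  also have "\<dots> = (\<Sum>j<n. \<Sum>i<n. if i = p j then cmod (M $$ (p j, j)) else 0)"
    using M mon by (intro sum.cong refl) (auto simp: monomial_mat_def)
  also have "\<dots> = (\<Sum>j<n. cmod (M $$ (p j, j)))"
    using p by (intro sum.cong refl) (auto simp: bij_betw_def)
  finally show ?thesis .
qed

text \<open>Lower half of the duality: a monomial \<open>V\<close> on the transposed support of
  \<open>M\<close> cancels the phases of its entries, so that the trace adds up their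
  moduli.\<close>

lemma monomial_l1_norm_attained:
  assumes M: "M \<in> carrier_mat n n" and p: "bij_betw p {..<n} {..<n}" and mon: "monomial_mat p M"
  obtains V where "V \<in> unitary_mats n" "mat_trace (V * M) = of_real (l1_norm M)"
proof
  \<comment> \<open>A zero entry has no phase, and \<open>sgn 0 = 0\<close> would spoil unitarity;
    hence the default 1.\<close>
  define u where "u j = (if M $$ (p j, j) = 0 then 1 else cnj (sgn (M $$ (p j, j))))" for j
  define V where "V = mat n n (\<lambda>(j, i). if i = p j then u j else 0)"
  have V: "V \<in> carrier_mat n n" by (simp add: V_def)
  have pl: "p j < n" if "j < n" for j using p that by (auto simp: bij_betw_def)
  have inj: "p i = p j \<longleftrightarrow> i = j" if "i < n" "j < n" for i j
    using p that by (auto simp: bij_betw_def inj_on_def)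
  have "cmod (u j) = 1" for j by (simp add: u_def norm_sgn)
  then have u: "u j * cnj (u j) = 1" for j by (simp flip: complex_norm_square)
  \<comment> \<open>This order of the factors is the easy one: row \<open>i\<close> of
    \<open>V\<close> is supported at column \<open>p i\<close>, so the sum collapses.\<close>
  have "V * mat_adjoint V = 1\<^sub>m n"
  proof (rule eq_matI)
    fix i j assume "i < dim_row (1\<^sub>m n :: complex mat)" "j < dim_col (1\<^sub>m n :: complex mat)"
    then have ij: "i < n" "j < n" by auto
    have "(V * mat_adjoint V) $$ (i, j) = (\<Sum>k<n. V $$ (i, k) * cnj (V $$ (j, k)))"
      using ij V by (subst index_mult_mat_sum[of _ n n _ n]) auto
    also have "\<dots> = (\<Sum>k<n. if k = p i then V $$ (i, p i) * cnj (V $$ (j, p i)) else 0)"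
      using ij pl by (intro sum.cong refl) (auto simp: V_def)
    also have "\<dots> = 1\<^sub>m n $$ (i, j)"
      using ij pl u inj by (simp add: V_def)
    finally show "(V * mat_adjoint V) $$ (i, j) = 1\<^sub>m n $$ (i, j)" .
  qed (use V in auto)
  then show "V \<in> unitary_mats n"
    using mat_mult_left_right_inverse[of V n "mat_adjoint V"] V by (simp add: unitary_mats_def)
  have "mat_trace (V * M) = (\<Sum>j<n. \<Sum>i<n. if i = p j then u j * M $$ (p j, j) else 0)"
    unfolding mat_trace_mult[OF V M] by (intro sum.cong refl) (simp add: V_def)
  also have "\<dots> = (\<Sum>j<n. u j * M $$ (p j, j))" using pl by simp
  also have "\<dots> = of_real (\<Sum>j<n. cmod (M $$ (p j, j)))"
    unfolding of_real_sum
  proof (intro sum.cong refl)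
    fix j
    have "cnj (sgn z) * z = of_real (cmod z)" for z
      
      using complex_norm_square[of z]
      by (auto simp: sgn_div_norm scaleR_conv_of_real divide_simps power2_eq_square mult.commute)
    then show "u j * M $$ (p j, j) = of_real (cmod (M $$ (p j, j)))" by (simp add: u_def)
  qed
  finally show "mat_trace (V * M) = of_real (l1_norm M)"
    by (simp add: l1_norm_monomial[OF M p mon])
qed

text \<open>The \<open>V\<close> that detects the norm of \<open>M\<close> is transported to a
  unitary \<open>W\<close> with the same trace pairing against \<open>P * M * Q\<close>, to which
  the trace bound applies.\<close>

lemma monomial_l1_norm_le:
  assumes M: "M \<in> carrier_mat n n" and p: "bij_betw p {..<n} {..<n}" and mon: "monomial_mat p M"
    and P: "P \<in> unitary_mats n" and Q: "Q \<in> unitary_mats n"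
  shows "l1_norm M \<le> l1_norm (P * M * Q)"
proof -
  note c = M unitary_carrier[OF P] unitary_carrier[OF Q]
  note assoc = assoc_mult_mat[of _ n n _ n _ n]
  obtain V where V: "V \<in> unitary_mats n" and tr: "mat_trace (V * M) = of_real (l1_norm M)"
    by (rule monomial_l1_norm_attained[OF M p mon])
  \<comment> \<open>\<open>W\<close> undoes \<open>P\<close> and \<open>Q\<close> under the trace;
    the factor for \<open>Q\<close> stands in front and reaches the end by cyclicity.\<close>
  define W where "W = mat_adjoint Q * (V * mat_adjoint P)"
  have W: "W \<in> unitary_mats n"
    unfolding W_def by (intro unitary_mult unitary_adjoint V P Q)
  note c = c unitary_carrier[OF V]
  have "mat_trace (W * (P * M * Q)) = mat_trace (mat_adjoint Q * (V * (mat_adjoint P * P) * M * Q))"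
    using c by (simp add: W_def assoc)
  also have "\<dots> = mat_trace (mat_adjoint Q * (V * M * Q))"
    using c by (simp add: unitary_left[OF P])
  also have "\<dots> = mat_trace (V * M * Q * mat_adjoint Q)"
    using c by (intro mat_trace_comm[of _ n n]) auto
  also have "\<dots> = mat_trace (V * M * (Q * mat_adjoint Q))"
    using c by (simp add: assoc)
  also have "\<dots> = of_real (l1_norm M)"
    using c tr by (simp add: unitary_right[OF Q])
  finally have "cmod (mat_trace (W * (P * M * Q))) = \<bar>l1_norm M\<bar>" by simp
  moreover have "cmod (mat_trace (W * (P * M * Q))) \<le> l1_norm (P * M * Q)"
    using c by (intro trace_unitary_le_l1_norm[OF W]) auto
  ultimately show ?thesis by simp
qed

section \<open>Unitary invariance of the Frobenius norm\<close>

lemma frobenius_norm_trace: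
  assumes "M \<in> carrier_mat n m"
  shows "complex_of_real ((frobenius_norm M)\<^sup>2) = mat_trace (mat_adjoint M * M)"
proof -
  have "(frobenius_norm M)\<^sup>2 = (\<Sum>i<m. \<Sum>k<n. (cmod (M $$ (k, i)))\<^sup>2)"
    using assms by (subst sum.swap) (simp add: frobenius_norm_def sum_nonneg)
  then show ?thesis
    using assms
    by (simp add: mat_trace_mult[of "mat_adjoint M" m n M] complex_norm_square mult.commute del: of_real_power)
qed

text \<open>In the trace form \<open>P\<close> cancels against its adjoint in the middle, and
  \<open>Q\<close> does so after a cyclic shift.\<close>

lemma frobenius_norm_unitary:
  assumes M: "M \<in> carrier_mat n n" and P: "P \<in> unitary_mats n" and Q: "Q \<in> unitary_mats n"
  shows "frobenius_norm (P * M * Q) = frobenius_norm M"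
proof -
  note c = M unitary_carrier[OF P] unitary_carrier[OF Q]
  note assoc = assoc_mult_mat[of _ n n _ n _ n]
  have "complex_of_real ((frobenius_norm (P * M * Q))\<^sup>2) = mat_trace (mat_adjoint (P * M * Q) * (P * M * Q))"
    using c by (intro frobenius_norm_trace[of _ n n]) auto
  also have "mat_adjoint (P * M * Q) * (P * M * Q) = mat_adjoint Q * (mat_adjoint M * (mat_adjoint P * P) * M * Q)"
    using c by (simp add: mat_adjoint_mult[of _ n n _ n] assoc)
  also have "\<dots> = mat_adjoint Q * (mat_adjoint M * M * Q)"
    using c by (simp add: unitary_left[OF P])
  also have "mat_trace \<dots> = mat_trace (mat_adjoint M * M * Q * mat_adjoint Q)"
    using c by (intro mat_trace_comm[of _ n n]) auto
  also have "\<dots> = mat_trace (mat_adjoint M * M * (Q * mat_adjoint Q))"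
    using c by (simp add: assoc)
  also have "\<dots> = complex_of_real ((frobenius_norm M)\<^sup>2)"
    using c by (simp add: unitary_right[OF Q] frobenius_norm_trace[OF M] del: of_real_power)
  finally have "(frobenius_norm (P * M * Q))\<^sup>2 = (frobenius_norm M)\<^sup>2"
    using of_real_eq_iff by blast
  then show ?thesis
    by (simp add: frobenius_norm_def sum_nonneg)
qed

subsection \<open>Unitary triangularization and matrix energy\<close>

text \<open>Completing \<open>v\<close> to a basis and orthogonalizing leaves \<open>v\<close> in
  first place, so normalizing merely rescales it. The factor \<open>c\<close> can stay unspecified
  because only the direction of an eigenvector matters.\<close>

lemma unitary_extend_column:
  assumes v: "v \<in> carrier_vec n" "v \<noteq> 0\<^sub>v n"
  obtains W c where "W \<in> unitary_mats n" "col W 0 = c \<cdot>\<^sub>v v"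
proof -
  interpret cof_vec_space n "TYPE(complex)" .
  define ws where "ws = gram_schmidt n (basis_completion v)"
  define b where "b = basis_completion v"
  note bc = basis_completion[OF v, folded b_def]
  have n: "n \<noteq> 0" using v by auto
  obtain vs where bv: "b = v # vs" using bc(6,7) n by (cases b) auto
  have ws: "set ws \<subseteq> carrier_vec n" "corthogonal ws" "length ws = n"
    using gram_schmidt_result[OF bc(2,4,5) refl] bc(6) by (auto simp: ws_def b_def)
  have hd: "ws ! 0 = v"
    using gram_schmidt_hd[OF v(1), of vs] ws(3) n hd_conv_nth[of ws]
    by (metis b_def bv list.size(3) ws_def)
  have wsc: "ws ! i \<in> carrier_vec n" if "i < n" for i using ws that by auto
  \<comment> \<open>The vectors in \<open>ws\<close> are orthogonal but not normalized;
    \<open>r i\<close> is the Euclidean length of \<open>ws ! i\<close>.\<close>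
  define r where "r i = sqrt (Re (ws ! i \<bullet>c ws ! i))" for i
  define W where "W = mat n n (\<lambda>(i, j). 1 / of_real (r j) * ws ! j $ i)"
  have sp: "(\<Sum>l<n. ws ! i $ l * cnj (ws ! j $ l)) = ws ! i \<bullet>c ws ! j" if "i < n" "j < n" for i j
    using wsc[OF that(1)] wsc[OF that(2)]
    by (auto simp: scalar_prod_def atLeast0LessThan conjugate_complex_def intro!: sum.cong)
  have r: "ws ! i \<bullet>c ws ! i = of_real (r i) * of_real (r i)" "r i \<noteq> 0" if "i < n" for i
  proof -
    have e: "ws ! i \<bullet>c ws ! i = of_real (\<Sum>l<n. (cmod (ws ! i $ l))\<^sup>2)"
      by (simp add: complex_norm_square del: of_real_power flip: sp[OF that that])
    have "ws ! i \<bullet>c ws ! i \<noteq> 0" using corthogonalD[OF ws(2)] ws(3) that by simp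
    moreover have "(\<Sum>l<n. (cmod (ws ! i $ l))\<^sup>2) \<ge> 0" by (simp add: sum_nonneg)
    ultimately show "ws ! i \<bullet>c ws ! i = of_real (r i) * of_real (r i)" "r i \<noteq> 0"
      unfolding r_def e Re_complex_of_real of_real_eq_0_iff by (simp_all flip: of_real_mult)
  qed
  have W: "W \<in> carrier_mat n n" by (simp add: W_def)
  have "mat_adjoint W * W = 1\<^sub>m n"
  proof (rule eq_matI)
    fix i j assume "i < dim_row (1\<^sub>m n :: complex mat)" "j < dim_col (1\<^sub>m n :: complex mat)"
    then have ij: "i < n" "j < n" by auto
    have "(mat_adjoint W * W) $$ (i, j)
        = (\<Sum>l<n. 1 / (of_real (r i) * of_real (r j)) * (ws ! j $ l * cnj (ws ! i $ l)))"
      using ij W by (subst index_mult_mat_sum[of _ n n _ n]) (auto simp: W_def intro!: sum.cong)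
    also have "\<dots> = 1 / (of_real (r i) * of_real (r j)) * (ws ! j \<bullet>c ws ! i)"
      unfolding sum_distrib_left[symmetric] sp[OF ij(2,1)] ..
    also have "\<dots> = 1\<^sub>m n $$ (i, j)"
      using ij corthogonalD[OF ws(2), of j i] ws(3) r(1)[of i] r(2)[of i] by (cases "i = j") simp_all
    finally show "(mat_adjoint W * W) $$ (i, j) = 1\<^sub>m n $$ (i, j)" .
  qed (use W in auto)
  then have "W \<in> unitary_mats n" using W by (simp add: unitary_mats_def)
  moreover have "col W 0 = (1 / of_real (r 0)) \<cdot>\<^sub>v v"
    using n v(1) by (intro eq_vecI) (auto simp: W_def hd)
  ultimately show ?thesis by (rule that)
qed

lemma adjoint_block_diag:
  fixes P :: "complex mat"
  assumes "P \<in> carrier_mat n n"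
  shows "mat_adjoint (four_block_mat (1\<^sub>m m) (0\<^sub>m m n) (0\<^sub>m n m) P)
    = four_block_mat (1\<^sub>m m) (0\<^sub>m m n) (0\<^sub>m n m) (mat_adjoint P)"
  by (rule eq_matI) (use assms in auto)

lemma unitary_block_diag:
  assumes "P \<in> unitary_mats n"
  shows "four_block_mat (1\<^sub>m m) (0\<^sub>m m n) (0\<^sub>m n m) P \<in> unitary_mats (m + n)"
proof -
  note c = unitary_carrier[OF assms]
  have "mat_adjoint (four_block_mat (1\<^sub>m m) (0\<^sub>m m n) (0\<^sub>m n m) P) *
      four_block_mat (1\<^sub>m m) (0\<^sub>m m n) (0\<^sub>m n m) P = 1\<^sub>m (m + n)"
    unfolding adjoint_block_diag[OF c]
    using c by (subst mult_four_block_mat[of _ m m _ n _ n])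
      (auto simp: unitary_left[OF assms] simp flip: four_block_one_mat)
  then show ?thesis using c by (auto simp: unitary_mats_def)
qed

text \<open>A unitary matrix with an eigenvector as first column clears the first column of
  \<open>A\<close> below the diagonal, and induction treats the remaining block. The l1 comparison
  needs unitary equivalence, not just similarity.\<close>

theorem unitary_schur:
  fixes A :: "complex mat"
  assumes "A \<in> carrier_mat n n"
  shows "\<exists>U \<in> unitary_mats n. upper_triangular (mat_adjoint U * A * U)"
  using assms
proof (induction n arbitrary: A)
  case 0
  then show ?case
    by (intro bexI[of _ "1\<^sub>m 0"]) (auto simp: unitary_mats_def)
next
  case (Suc n A)
  note A = Suc.prems
  note assoc = assoc_mult_mat[of _ "Suc n" "Suc n" _ "Suc n" _ "Suc n"]
  obtain e where "eigenvalue A e"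
    using spectrum_non_empty[OF A] by (auto simp: spectrum_def)
  then obtain v where v: "v \<in> carrier_vec (Suc n)" "v \<noteq> 0\<^sub>v (Suc n)" and ev: "A *\<^sub>v v = e \<cdot>\<^sub>v v"
    using A by (auto simp: eigenvalue_def eigenvector_def)
  obtain W c where W: "W \<in> unitary_mats (Suc n)" and c: "col W 0 = c \<cdot>\<^sub>v v"
    by (rule unitary_extend_column[OF v])
  note Wc = unitary_carrier[OF W]
  define A' where "A' = mat_adjoint W * A * W"
  have A': "A' \<in> carrier_mat (Suc n) (Suc n)" using A Wc by (auto simp: A'_def)
  \<comment> \<open>The first column of \<open>W\<close> is a multiple of \<open>v\<close> and so
    satisfies the same eigenvalue equation.\<close>
  have AW: "col (A * W) 0 = e \<cdot>\<^sub>v col W 0"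
proof -
    have "col (A * W) 0 = A *\<^sub>v (c \<cdot>\<^sub>v v)"
      using col_mult2[OF A Wc, of 0] by (simp only: c zero_less_Suc)
    also have "\<dots> = c \<cdot>\<^sub>v (e \<cdot>\<^sub>v v)"
      using mult_mat_vec[OF A v(1)] by (simp add: ev)
    finally show ?thesis by (simp add: c smult_smult_assoc mult.commute)
  qed
  \<comment> \<open>By \<open>AW\<close> this entry is \<open>e\<close> times an off-diagonal entry
    of \<open>mat_adjoint W * W\<close>, the identity.\<close>
  have A'0: "A' $$ (i, 0) = 0" if "i < Suc n" "i \<noteq> 0" for i
  proof -
    have "A' $$ (i, 0) = row (mat_adjoint W) i \<bullet> col (A * W) 0"
      using A Wc that by (simp add: A'_def assoc)
    also have "\<dots> = e * (row (mat_adjoint W) i \<bullet> col W 0)"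
      unfolding AW using Wc that by (intro scalar_prod_smult_distrib[of _ "Suc n"]) (auto intro: col_carrier_vec)
    also have "row (mat_adjoint W) i \<bullet> col W 0 = (mat_adjoint W * W) $$ (i, 0)"
      using Wc that by simp
    also have "\<dots> = 0" using that by (simp add: unitary_left[OF W])
    finally show ?thesis by simp
  qed
  obtain A1 A2 A0 A3 where split: "split_block A' 1 1 = (A1, A2, A0, A3)"
    by (cases "split_block A' 1 1") auto
  note sb = split_block[OF split, of n n]
  have A1: "A1 \<in> carrier_mat 1 1" and A2: "A2 \<in> carrier_mat 1 n" and A0c: "A0 \<in> carrier_mat n 1"
    and A3: "A3 \<in> carrier_mat n n" and A'b: "A' = four_block_mat A1 A2 A0 A3"
    using sb A' by auto
  have A0: "A0 = 0\<^sub>m n 1"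
  proof (rule eq_matI)
    fix i j assume "i < dim_row (0\<^sub>m n 1 :: complex mat)" "j < dim_col (0\<^sub>m n 1 :: complex mat)"
    then have ij: "i < n" "j = 0" by auto
    then have "A0 $$ (i, j) = A' $$ (Suc i, 0)" unfolding A'b using A0c A1 A3 by auto
    then show "A0 $$ (i, j) = 0\<^sub>m n 1 $$ (i, j)" using A'0 ij by simp
  qed (use A0c in auto)
  obtain P where P: "P \<in> unitary_mats n" and ut: "upper_triangular (mat_adjoint P * A3 * P)"
    using Suc.IH[OF A3] by blast
  note Pc = unitary_carrier[OF P]
  \<comment> \<open>Acting trivially on the first coordinate, \<open>P'\<close> keeps the zeros of
    the first column while triangularizing \<open>A3\<close>.\<close>
  define P' where "P' = four_block_mat (1\<^sub>m 1) (0\<^sub>m 1 n) (0\<^sub>m n 1) P"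
  have P': "P' \<in> unitary_mats (Suc n)" using unitary_block_diag[OF P, of 1] by (simp add: P'_def)
  note P'c = unitary_carrier[OF P']
  have step1: "mat_adjoint P' * A' = four_block_mat A1 A2 (0\<^sub>m n 1) (mat_adjoint P * A3)"
    unfolding A'b A0 P'_def adjoint_block_diag[OF Pc]
    using A1 A2 A3 Pc by (subst mult_four_block_mat[of _ 1 1 _ n _ n _ _ 1 _ n]) auto
  have step2: "mat_adjoint P' * A' * P' = four_block_mat A1 (A2 * P) (0\<^sub>m n 1) (mat_adjoint P * A3 * P)"
    unfolding step1 unfolding P'_def
    using A1 A2 A3 Pc mult_carrier_mat[of "mat_adjoint P" n n A3 n] by (subst mult_four_block_mat[of _ 1 1 _ n _ n _ _ 1 _ n]) auto
  have "upper_triangular (mat_adjoint P' * A' * P')"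
    unfolding step2 
    by (rule upper_triangular_four_block[of _ 1 _ n, OF _ _ _ ut]) (use A1 A3 Pc in \<open>auto simp: upper_triangular_def\<close>)
  also have "mat_adjoint P' * A' * P' = mat_adjoint (W * P') * A * (W * P')"
    using A Wc P'c by (simp add: A'_def assoc mat_adjoint_mult[of _ "Suc n" "Suc n" _ "Suc n"])
  finally show ?case using unitary_mult[OF W P'] by blast
qed

text \<open>The characteristic polynomial splits over the diagonal of \<open>B\<close>, so algebraic
  multiplicities count repetitions on that diagonal.\<close>

lemma mat_energy_upper_triangular:
  assumes A: "A \<in> carrier_mat n n" and sim: "similar_mat A B" and B: "B \<in> carrier_mat n n"
    and ut: "upper_triangular B"
  shows "mat_energy A = (\<Sum>i<n. cmod (B $$ (i, i)))"
proof -
  define es where "es = diag_mat B"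
  have cp: "char_poly A = (\<Prod>a\<leftarrow>es. [:- a, 1:])"
    using char_poly_similar[OF sim] char_poly_upper_triangular[OF B ut] by (simp add: es_def)
  have spec: "spectrum A = set es"
    unfolding spectrum_root_char_poly[OF A] cp by (auto simp: poly_prod_list prod_list_zero_iff)
  have ord: "order \<mu> (char_poly A) = (\<Sum>i<n. if B $$ (i, i) = \<mu> then 1 else 0)" for \<mu>
  proof -
    have "order \<mu> (char_poly A) = sum_list (map (\<lambda>a. order \<mu> [:- a, 1:]) es)"
      unfolding cp by (subst order_prod_list) (auto simp: o_def)
    also have "(\<lambda>a. order \<mu> [:- a, 1:]) = (\<lambda>a. if a = \<mu> then 1 else 0)"
      using order_power_n_n[of _ 1] by (auto simp: order_0I)
    finally show ?thesis
      using B by (simp add: es_def diag_mat_def sum_list_sum_nth atLeast0LessThan)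
  qed
  have mem: "B $$ (i, i) \<in> spectrum A" if "i < n" for i
    using B that by (auto simp: spec es_def diag_mat_def)
  have "mat_energy A = (\<Sum>\<mu>\<in>spectrum A. \<Sum>i<n. if B $$ (i, i) = \<mu> then cmod \<mu> else 0)"
    by (simp add: mat_energy_def ord sum_distrib_right if_distrib[of real] if_distribR cong: if_cong)
      (auto intro!: sum.cong)
  \<comment> \<open>After the swap only the eigenvalue equal to the \<open>i\<close>-th diagonal
    entry contributes, and \<open>mem\<close> places it in the range of summation.\<close>
  also have "\<dots> = (\<Sum>i<n. cmod (B $$ (i, i)))"
    using mem card_finite_spectrum(1)[OF A] by (subst sum.swap) simp
  finally show ?thesis .
qed

text \<open>The Schur form of a Hermitian matrix is again Hermitian, hence diagonal. Diagonality is
  phrased as \<open>monomial_mat id\<close> so that the minimality of monomial matrices applies to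
  \<open>D\<close>.\<close>

lemma hermitian_diagonalization:
  assumes A: "A \<in> carrier_mat n n" and herm: "mat_adjoint A = A"
  obtains U D where "U \<in> unitary_mats n" "D \<in> carrier_mat n n" "monomial_mat id D"
    "A = U * D * mat_adjoint U" "l1_norm D = mat_energy A"
proof -
  note assoc = assoc_mult_mat[of _ n n _ n _ n]
  obtain U where U: "U \<in> unitary_mats n" and ut: "upper_triangular (mat_adjoint U * A * U)"
    using unitary_schur[OF A] by blast
  note Uc = unitary_carrier[OF U]
  define D where "D = mat_adjoint U * A * U"
  have D: "D \<in> carrier_mat n n" using A Uc by (auto simp: D_def)
  have Dh: "mat_adjoint D = D"
    using A Uc herm by (simp add: D_def mat_adjoint_mult[of _ n n _ n] assoc)
  have mon: "monomial_mat id D"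
    unfolding monomial_mat_def
  proof (intro allI impI)
    fix i j assume ij: "i < dim_row D" "j < dim_col D" "i \<noteq> id j"
    have lower: "D $$ (k, l) = 0" if "k < n" "l < k" for k l
      using ut D that unfolding D_def[symmetric] upper_triangular_def by auto
    show "D $$ (i, j) = 0"
    proof (cases "j < i")
      case False
      \<comment> \<open>Above the diagonal an entry is the conjugate of its mirror image, which
        triangularity makes zero.\<close>
      then have "D $$ (j, i) = 0" using lower ij D by auto
      then have "mat_adjoint D $$ (i, j) = 0" using ij D by simp
      then show ?thesis by (simp add: Dh)
    qed (use lower ij D in auto)
  qed
  have "U * D * mat_adjoint U = U * mat_adjoint U * A * (U * mat_adjoint U)"
    using A Uc by (simp add: D_def assoc)
  then have AD: "A = U * D * mat_adjoint U"
    using A by (simp add: unitary_right[OF U])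
  have "similar_mat A D"
    unfolding similar_mat_def
    using similar_mat_witI[OF unitary_right[OF U] unitary_left[OF U] AD A D Uc] Uc by auto
  then have "mat_energy A = l1_norm D"
    using mat_energy_upper_triangular[OF A _ D] ut D l1_norm_monomial[OF D _ mon]
    by (simp add: D_def[symmetric] bij_betw_id)
  then show ?thesis using that[OF U D mon AD] by simp
qed

subsection \<open>The Fourier matrix and adjacency matrices\<close>

text \<open>The Fourier kernel as a character of the integers with period \<open>N\<close>; integer
  arguments let exponents be negated and reduced modulo \<open>N\<close>.\<close>

definition root_char :: "nat \<Rightarrow> int \<Rightarrow> complex" where
  "root_char N k = cis (- 2 * pi * of_int k / of_nat N)"

lemma root_char_add: "root_char N (k + l) = root_char N k * root_char N l"
  by (simp add: root_char_def cis_mult add_divide_distrib diff_divide_distrib distrib_left)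

lemma root_char_mult_nat: "root_char N (k * int n) = root_char N k ^ n"
  by (simp add: root_char_def DeMoivre mult_ac)

lemma cnj_root_char: "cnj (root_char N k) = root_char N (- k)"
  by (simp add: root_char_def cis_cnj)

lemma root_char_eq_1_iff:
  assumes "N > 0"
  shows "root_char N k = 1 \<longleftrightarrow> int N dvd k"
proof
  assume "root_char N k = 1"
  \<comment> \<open>The real part alone decides: a cosine equal to 1 forces a multiple of
    \<open>2 * pi\<close>.\<close>
  then have "cos (- 2 * pi * of_int k / of_nat N) = 1"
    unfolding root_char_def by (metis cis.sel(1) one_complex.sel(1))
  then obtain m :: int where "- 2 * pi * of_int k / of_nat N = of_int m * 2 * pi"
    using cos_one_2pi_int by blast
  then have "pi * (- real_of_int k) = pi * (real_of_int m * real N)"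
    using assms by (simp add: field_simps)
  then have "- real_of_int k = real_of_int m * real N"
    using mult_left_cancel[of pi] pi_neq_zero by blast
  then have "real_of_int (- k) = real_of_int (m * int N)" by simp
  then have "- k = m * int N" unfolding of_int_eq_iff .
  then show "int N dvd k" by (metis dvd_minus_iff dvd_triv_right)
next
  assume "int N dvd k"
  then obtain m where "k = int N * m" by blast
  then have "- 2 * pi * of_int k / of_nat N = 2 * pi * of_int (- m)"
    using assms by simp
  then show "root_char N k = 1"
    unfolding root_char_def using cis_multiple_2pi[of "of_int (- m)"] by simp
qed

lemma root_char_mod:
  assumes "N > 0"
  shows "root_char N (k mod int N) = root_char N k"
proof -
  have "root_char N k = root_char N (k mod int N) * root_char N (int N * (k div int N))"
    by (simp flip: root_char_add)
  then show ?thesis using root_char_eq_1_iff[OF assms, of "int N * (k div int N)"] by simp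
qed

text \<open>Orthogonality of characters: a geometric series in an \<open>N\<close>-th root of unity
  that equals 1 exactly when \<open>N\<close> divides \<open>k\<close>.\<close>

lemma root_char_sum:
  assumes "N > 0"
  shows "(\<Sum>x<N. root_char N (k * int x)) = (if int N dvd k then of_nat N else 0)"
proof (cases "int N dvd k")
  case True
  then have "root_char N k = 1" using root_char_eq_1_iff[OF assms] by simp
  then show ?thesis using True by (simp add: root_char_mult_nat)
next
  case False
  then have "root_char N k \<noteq> 1" using root_char_eq_1_iff[OF assms] by simp
  moreover have "root_char N k ^ N = 1"
    using root_char_eq_1_iff[OF assms, of "k * int N"] by (simp flip: root_char_mult_nat)
  ultimately show ?thesis
    using False by (simp add: root_char_mult_nat geometric_sum)
qed

lemma dvd_diff_less_iff: "i < N \<Longrightarrow> j < N \<Longrightarrow> int N dvd int i - int j \<longleftrightarrow> i = j"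
  by (simp flip: mod_eq_dvd_iff)

lemma index_fourier_mat:
  assumes "m < N" "x < N"
  shows "fourier_mat N $$ (m, x) = root_char N (int m * int x) / of_real (sqrt (real N))"
  using assms by (simp add: fourier_mat_def root_char_def cis_conv_exp mult_ac)

lemma fourier_mat_unitary: "fourier_mat N \<in> unitary_mats N"
proof -
  have F: "fourier_mat N \<in> carrier_mat N N" by (simp add: fourier_mat_def)
  have sq: "complex_of_real (sqrt (real N)) * complex_of_real (sqrt (real N)) = of_nat N"
    by (simp flip: of_real_mult)
  have "mat_adjoint (fourier_mat N) * fourier_mat N = 1\<^sub>m N"
  proof (rule eq_matI)
    fix i j assume "i < dim_row (1\<^sub>m N :: complex mat)" "j < dim_col (1\<^sub>m N :: complex mat)"
    then have ij: "i < N" "j < N" by auto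
    have "(mat_adjoint (fourier_mat N) * fourier_mat N) $$ (i, j)
        = (\<Sum>m<N. root_char N (- (int m * int i)) * root_char N (int m * int j) / of_nat N)"
      using ij F by (subst index_mult_mat_sum[of _ N N _ N])
        (auto simp: index_fourier_mat cnj_root_char sq intro!: sum.cong)
    also have "\<dots> = (\<Sum>m<N. root_char N ((int j - int i) * int m)) / of_nat N"
      by (simp add: sum_divide_distrib algebra_simps flip: root_char_add)
    also have "\<dots> = 1\<^sub>m N $$ (i, j)"
      using ij dvd_diff_less_iff[of j N i] by (auto simp: root_char_sum)
    finally show "(mat_adjoint (fourier_mat N) * fourier_mat N) $$ (i, j) = 1\<^sub>m N $$ (i, j)" .
  qed (use F in auto)
  with F show ?thesis by (simp add: unitary_mats_def)
qed

section \<open>Fourier transform of affinely invariant matrices\<close>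

lemma sum_mod_shift:
  fixes g :: "int \<Rightarrow> 'a :: comm_monoid_add"
  assumes "N > 0"
  shows "(\<Sum>y\<in>ZMod N. g y) = (\<Sum>t\<in>ZMod N. g ((c + t) mod int N))"
proof (rule sum.reindex_bij_witness[of _ "\<lambda>t. (c + t) mod int N" "\<lambda>y. (y - c) mod int N"])
qed (use assms in \<open>auto simp: ZMod_def mod_simps\<close>)

lemma sum_ZMod: "(\<Sum>y\<in>ZMod N. g y) = (\<Sum>y<N. g (int y))"
  by (rule sum.reindex_bij_witness[of _ int nat]) (auto simp: ZMod_def)

text \<open>Substituting \<open>y = a * x + t\<close> factors the double sum into a sum over
  \<open>t\<close> involving \<open>h\<close> and a sum over \<open>x\<close> of the character at
  \<open>(m + a * n) * x\<close>; the latter vanishes by orthogonality.\<close>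

lemma fourier_affine_eq_0:
  assumes N: "N > 0" and A: "A \<in> carrier_mat N N"
    and Axy: "\<And>x y. x < N \<Longrightarrow> y < N \<Longrightarrow> A $$ (x, y) = h ((int y - a * int x) mod int N)"
    and mn: "m < N" "n < N" "\<not> int N dvd int m + a * int n"
  shows "(fourier_mat N * A * fourier_mat N) $$ (m, n) = 0"
proof -
  have F: "fourier_mat N \<in> carrier_mat N N" by (simp add: fourier_mat_def)
  have sq: "complex_of_real (sqrt (real N)) * complex_of_real (sqrt (real N)) = of_nat N"
    by (simp flip: of_real_mult)
  \<comment> \<open>On the right the sum over \<open>t\<close> is free of \<open>x\<close>; all
    dependence on \<open>x\<close> sits in one character value.\<close>
  have inner: "(\<Sum>y<N. A $$ (x, y) * root_char N (int y * int n))
      = root_char N (a * int n * int x) * (\<Sum>t\<in>ZMod N. h t * root_char N (t * int n))"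
    if x: "x < N" for x
  proof -
    have "(\<Sum>y<N. A $$ (x, y) * root_char N (int y * int n))
        = (\<Sum>y\<in>ZMod N. h ((y - a * int x) mod int N) * root_char N (y * int n))"
      using x by (simp add: sum_ZMod Axy)
    also have "\<dots> = (\<Sum>t\<in>ZMod N. h (((a * int x + t) mod int N - a * int x) mod int N)
        * root_char N ((a * int x + t) mod int N * int n))"
      by (rule sum_mod_shift[OF N])
    also have "\<dots> = (\<Sum>t\<in>ZMod N. root_char N (a * int n * int x) * (h t * root_char N (t * int n)))"
    proof (rule sum.cong[OF refl])
      fix t assume t: "t \<in> ZMod N"
      have "root_char N ((a * int x + t) mod int N * int n) = root_char N ((a * int x + t) * int n)"
        using root_char_mod[OF N, of "(a * int x + t) mod int N * int n"]
          root_char_mod[OF N, of "(a * int x + t) * int n"] by (simp add: mod_simps)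
      also have "\<dots> = root_char N (a * int n * int x) * root_char N (t * int n)"
        by (simp add: algebra_simps flip: root_char_add)
      finally show "h (((a * int x + t) mod int N - a * int x) mod int N)
          * root_char N ((a * int x + t) mod int N * int n)
          = root_char N (a * int n * int x) * (h t * root_char N (t * int n))"
        using t by (simp add: mod_simps ZMod_def)
    qed
    finally show ?thesis by (simp add: sum_distrib_left)
  qed
  have "(fourier_mat N * A * fourier_mat N) $$ (m, n)
      = (\<Sum>y<N. (\<Sum>x<N. fourier_mat N $$ (m, x) * A $$ (x, y)) * fourier_mat N $$ (y, n))"
    using F A mn by (subst index_mult_mat_sum[of _ N N _ N])
      (auto simp: index_mult_mat_sum[of _ N N _ N] simp del: index_mult_mat intro!: sum.cong)
  also have "\<dots> = (\<Sum>x<N. \<Sum>y<N. fourier_mat N $$ (m, x) * A $$ (x, y) * fourier_mat N $$ (y, n))"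
    unfolding sum_distrib_right by (rule sum.swap)
  also have "\<dots> = (\<Sum>x<N. root_char N (int m * int x) * (\<Sum>y<N. A $$ (x, y) * root_char N (int y * int n))) / of_nat N"
    unfolding sum_divide_distrib sum_distrib_left
    using mn by (intro sum.cong refl) (simp add: index_fourier_mat sq mult.assoc)
  also have "\<dots> = (\<Sum>x<N. root_char N ((int m + a * int n) * int x) * (\<Sum>t\<in>ZMod N. h t * root_char N (t * int n))) / of_nat N"
    by (simp add: inner algebra_simps root_char_add)
  also have "\<dots> = 0"
    using mn(3) by (simp add: root_char_sum[OF N] flip: sum_distrib_right)
  finally show ?thesis .
qed

section \<open>Adjacency matrices of labelled graphs\<close>

lemma card_adjacent_pairs:
  assumes "simple_graph G"
  shows "card {(u, v). u \<in> verts G \<and> v \<in> verts G \<and> adjacent G u v} = 2 * card (edges G)"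
proof -
  have E: "edges G \<subseteq> {{u, v} |u v. u \<in> verts G \<and> v \<in> verts G \<and> u \<noteq> v}" and fin: "finite (verts G)"
    using assms by (simp_all add: simple_graph_def)
  have finE: "finite (edges G)"
    using E fin by (intro finite_subset[of "edges G" "Pow (verts G)"]) fast+
  \<comment> \<open>The ordered pairs are grouped by edge; each edge has two orientations, distinct
    because there are no loops.\<close>
  have "{(u, v). u \<in> verts G \<and> v \<in> verts G \<and> adjacent G u v} = (\<Union>e\<in>edges G. {(u, v). {u, v} = e})"
  proof -
    have "u \<in> verts G \<and> v \<in> verts G" if "{u, v} \<in> edges G" for u v
    proof -
      obtain u' v' where "{u, v} = {u', v'}" "u' \<in> verts G" "v' \<in> verts G"
        using E \<open>{u, v} \<in> edges G\<close> by blast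
      then show ?thesis by (metis doubleton_eq_iff)
    qed
    then show ?thesis unfolding adjacent_def by blast
  qed
  also have "card \<dots> = (\<Sum>e\<in>edges G. card {(u, v). {u, v} = e})"
  proof (rule card_UN_disjoint[OF finE])
    show "\<forall>e\<in>edges G. finite {(u, v). {u, v} = e}"
    proof
      fix e assume "e \<in> edges G"
      then have "finite e" using E by fast
      moreover have "{(u, v). {u, v} = e} \<subseteq> e \<times> e" by blast
      ultimately show "finite {(u, v). {u, v} = e}" by (meson finite_SigmaI finite_subset)
    qed
  qed blast
  also have "\<dots> = (\<Sum>e\<in>edges G. 2)"
  proof (rule sum.cong[OF refl])
    fix e assume "e \<in> edges G"
    with E obtain u v where "e = {u, v}" "u \<noteq> v" by fast
    then have "{(u, v). {u, v} = e} = {(u, v), (v, u)}" by (auto simp: doubleton_eq_iff)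
    then show "card {(u, v). {u, v} = e} = 2" using \<open>u \<noteq> v\<close> by simp
  qed
  finally show ?thesis by simp
qed

lemma adj_mat_carrier: "adj_mat G \<sigma> \<in> carrier_mat (card (verts G)) (card (verts G))"
  by (simp add: adj_mat_def Let_def)

lemma adj_mat_hermitian: "mat_adjoint (adj_mat G \<sigma>) = adj_mat G \<sigma>"
proof -
  have "adjacent G u v \<longleftrightarrow> adjacent G v u" for u v
    by (simp add: adjacent_def insert_commute)
  then show ?thesis by (intro eq_matI) (simp_all add: adj_mat_def Let_def)
qed

text \<open>The squared entries are 0 or 1 and count ordered adjacent pairs, two for each edge,
  whatever the labeling.\<close>

lemma frobenius_norm_adj_mat:
  assumes G: "simple_graph G" and \<sigma>: "\<sigma> \<in> labelings G"
  shows "frobenius_norm (adj_mat G \<sigma>) = sqrt (2 * real (card (edges G)))"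
proof -
  define N where "N = card (verts G)"
  define \<tau> where "\<tau> i = inv_into (verts G) \<sigma> (int i)" for i
  have "bij_betw \<sigma> (verts G) (ZMod N)" using \<sigma> by (simp add: labelings_def N_def)
  then have "bij_betw (inv_into (verts G) \<sigma> \<circ> int) {..<N} (verts G)"
    by (intro bij_betw_trans[OF _ bij_betw_inv_into])
      (rule bij_betw_byWitness[where f' = nat], auto simp: ZMod_def)
  then have \<tau>: "bij_betw \<tau> {..<N} (verts G)" by (simp add: \<tau>_def[abs_def] o_def)
  have fin: "finite (verts G)" using G by (simp add: simple_graph_def)
  have "(\<Sum>i<N. \<Sum>j<N. (cmod (adj_mat G \<sigma> $$ (i, j)))\<^sup>2)
      = (\<Sum>i<N. \<Sum>j<N. if adjacent G (\<tau> i) (\<tau> j) then 1 else 0)"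
    by (intro sum.cong refl) (auto simp: adj_mat_def Let_def \<tau>_def N_def)
  also have "\<dots> = (\<Sum>u\<in>verts G. \<Sum>v\<in>verts G. if adjacent G u v then 1 else 0)"
    using sum.reindex_bij_betw[OF \<tau>, of "\<lambda>u. \<Sum>v\<in>verts G. if adjacent G u v then 1 else 0"]
    by (simp only: sum.reindex_bij_betw[OF \<tau>, of "\<lambda>v. if adjacent G _ v then 1 else 0"])
  also have "\<dots> = real (card {(u, v). u \<in> verts G \<and> v \<in> verts G \<and> adjacent G u v})"
  proof -
    have "{(u, v). u \<in> verts G \<and> v \<in> verts G \<and> adjacent G u v}
        = (SIGMA u:verts G. {v \<in> verts G. adjacent G u v})" by auto
    then show ?thesis
      using fin by (simp add: card_SigmaI sum.If_cases Int_def)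
  qed
  finally show ?thesis
    by (simp add: frobenius_norm_def card_adjacent_pairs[OF G] adj_mat_def Let_def N_def)
qed

subsection \<open>Edge complexity and energy\<close>

text \<open>The diagonal form \<open>D\<close> is monomial and differs from \<open>P * A * Q\<close>
  by unitary factors. With both factors Fourier matrices this is the lower bound for every
  labeling.\<close>

lemma mat_energy_le_l1_norm_unitary:
  assumes A: "A \<in> carrier_mat n n" and herm: "mat_adjoint A = A"
    and P: "P \<in> unitary_mats n" and Q: "Q \<in> unitary_mats n"
  shows "mat_energy A \<le> l1_norm (P * A * Q)"
proof -
  obtain U D where U: "U \<in> unitary_mats n" and D: "D \<in> carrier_mat n n" "monomial_mat id D"
    and AD: "A = U * D * mat_adjoint U" and en: "l1_norm D = mat_energy A"
    by (rule hermitian_diagonalization[OF A herm])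
  have "P * A * Q = (P * U) * D * (mat_adjoint U * Q)"
    using D(1) unitary_carrier[OF U] unitary_carrier[OF P] unitary_carrier[OF Q]
    by (simp add: AD assoc_mult_mat[of _ n n _ n _ n])
  moreover have "l1_norm D \<le> l1_norm ((P * U) * D * (mat_adjoint U * Q))"
    using D U P Q by (intro monomial_l1_norm_le[of _ n id] unitary_mult unitary_adjoint) (simp_all add: bij_betw_id)
  ultimately show ?thesis by (simp add: en)
qed

text \<open>When \<open>P * A * Q\<close> is monomial as well, minimality applies in both directions
  between it and \<open>D\<close>.\<close>

lemma l1_norm_monomial_unitary_eq_energy:
  assumes A: "A \<in> carrier_mat n n" and herm: "mat_adjoint A = A"
    and P: "P \<in> unitary_mats n" and Q: "Q \<in> unitary_mats n"
    and p: "bij_betw p {..<n} {..<n}" and mon: "monomial_mat p (P * A * Q)"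
  shows "l1_norm (P * A * Q) = mat_energy A"
proof (rule antisym)
  obtain U D where U: "U \<in> unitary_mats n" and D: "D \<in> carrier_mat n n"
    and AD: "A = U * D * mat_adjoint U" and en: "l1_norm D = mat_energy A"
    by (rule hermitian_diagonalization[OF A herm])
  note assoc = assoc_mult_mat[of _ n n _ n _ n]
  note c = unitary_carrier[OF U] unitary_carrier[OF P] unitary_carrier[OF Q]
  \<comment> \<open>\<open>D\<close> is recovered from \<open>P * A * Q\<close> by removing
    \<open>P\<close> and \<open>Q\<close> and then diagonalizing \<open>A\<close>.\<close>
  have "(mat_adjoint U * mat_adjoint P) * (P * A * Q) * (mat_adjoint Q * U)
      = mat_adjoint U * ((mat_adjoint P * P) * A * (Q * mat_adjoint Q)) * U"
    using A c by (simp add: assoc)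
  also have "\<dots> = mat_adjoint U * A * U"
    using A c by (simp add: unitary_left[OF P] unitary_right[OF Q])
  also have "\<dots> = (mat_adjoint U * U) * D * (mat_adjoint U * U)"
    using D c by (simp add: AD assoc)
  also have "\<dots> = D" using D by (simp add: unitary_left[OF U])
  finally have "D = (mat_adjoint U * mat_adjoint P) * (P * A * Q) * (mat_adjoint Q * U)" ..
  moreover have "l1_norm (P * A * Q) \<le> l1_norm ((mat_adjoint U * mat_adjoint P) * (P * A * Q) * (mat_adjoint Q * U))"
    using A c U P Q by (intro monomial_l1_norm_le[OF _ p mon] unitary_mult unitary_adjoint) simp_all
  ultimately show "l1_norm (P * A * Q) \<le> mat_energy A" by (simp flip: en)
qed (rule mat_energy_le_l1_norm_unitary[OF A herm P Q])

lemma bij_betw_mult_mod: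
  assumes "N > 0" and "coprime c (int N)"
  shows "bij_betw (\<lambda>n. nat ((c * int n) mod int N)) {..<N} {..<N}"
proof -
  have "inj_on (\<lambda>n. nat ((c * int n) mod int N)) {..<N}"
  proof (rule inj_onI)
    fix i j assume ij: "i \<in> {..<N}" "j \<in> {..<N}"
      and "nat ((c * int i) mod int N) = nat ((c * int j) mod int N)"
    then have "[c * int i = c * int j] (mod int N)"
      using assms(1) by (simp add: cong_def nat_eq_iff)
    then have "[int i = int j] (mod int N)"
      using assms(2) by (simp add: cong_mult_lcancel)
    then show "i = j" using ij by (simp add: cong_def)
  qed
  moreover have "(\<lambda>n. nat ((c * int n) mod int N)) ` {..<N} \<subseteq> {..<N}"
    using assms(1) by (auto simp: nat_less_iff)
  ultimately show ?thesis
    by (simp add: bij_betw_def endo_inj_surj)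
qed

text \<open>The Fourier matrix is unitary, so the denominator is the same for all labelings and only
  the l1-norm is left to minimize.\<close>

lemma fourier_ratio_adj_mat:
  assumes G: "simple_graph G" and \<sigma>: "\<sigma> \<in> labelings G"
  shows "fourier_ratio (adj_mat G \<sigma>) =
    l1_norm (fourier_mat (card (verts G)) * adj_mat G \<sigma> * fourier_mat (card (verts G)))
      / sqrt (2 * real (card (edges G)))"
  using frobenius_norm_unitary[OF adj_mat_carrier[of G \<sigma>] fourier_mat_unitary fourier_mat_unitary]
    frobenius_norm_adj_mat[OF G \<sigma>] adj_mat_carrier[of G \<sigma>]
  by (simp add: fourier_ratio_def Let_def)

text \<open>The energy bound holds for every labeling, so a single labeling with monomial Fourier
  transform settles the minimum.\<close>

theorem edge_complexity_eq_energy: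
  assumes G: "simple_graph G" and \<sigma>: "\<sigma> \<in> labelings G"
    and p: "bij_betw p {..<card (verts G)} {..<card (verts G)}"
    and mon: "monomial_mat p (fourier_mat (card (verts G)) * adj_mat G \<sigma> * fourier_mat (card (verts G)))"
  shows "edge_complexity G = graph_energy G / sqrt (2 * real (card (edges G)))"
  unfolding edge_complexity_def
proof (rule Min_eqI)
  show "finite ((\<lambda>\<sigma>. fourier_ratio (adj_mat G \<sigma>)) ` labelings G)"
    using G finite_labelings[of G] by (simp add: simple_graph_def)
next
  fix r assume "r \<in> (\<lambda>\<sigma>. fourier_ratio (adj_mat G \<sigma>)) ` labelings G"
  then obtain \<tau> where \<tau>: "\<tau> \<in> labelings G" and r: "r = fourier_ratio (adj_mat G \<tau>)" by blast
  show "graph_energy G / sqrt (2 * real (card (edges G))) \<le> r"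
    unfolding r fourier_ratio_adj_mat[OF G \<tau>] graph_energy_eq[OF \<tau>]
    by (rule divide_right_mono[OF mat_energy_le_l1_norm_unitary[OF adj_mat_carrier
            adj_mat_hermitian fourier_mat_unitary fourier_mat_unitary]]) simp
next
  have "fourier_ratio (adj_mat G \<sigma>) = graph_energy G / sqrt (2 * real (card (edges G)))"
    unfolding fourier_ratio_adj_mat[OF G \<sigma>] graph_energy_eq[OF \<sigma>]
    using l1_norm_monomial_unitary_eq_energy[OF adj_mat_carrier adj_mat_hermitian
        fourier_mat_unitary fourier_mat_unitary p mon] by simp
  then show "graph_energy G / sqrt (2 * real (card (edges G)))
      \<in> (\<lambda>\<sigma>. fourier_ratio (adj_mat G \<sigma>)) ` labelings G"
    using \<sigma> by (metis imageI)
qed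

section \<open>The graph defined by the affine condition\<close>

lemma affine_reflection_symmetric:
  assumes a: "[a\<^sup>2 = 1] (mod int N)" and S: "S = (\<lambda>t. (- a * t) mod int N) ` S"
    and xy: "(y - a * x) mod int N \<in> S"
  shows "(x - a * y) mod int N \<in> S"
proof -
  \<comment> \<open>Exchanging \<open>x\<close> and \<open>y\<close> multiplies
    \<open>y - a * x\<close> by \<open>- a\<close> modulo \<open>N\<close>, and \<open>S\<close> is
    stable under this multiplication.\<close>
  have "[- a * (y - a * x) = a\<^sup>2 * x - a * y] (mod int N)"
    by (simp add: algebra_simps power2_eq_square)
  also have "[a\<^sup>2 * x - a * y = 1 * x - a * y] (mod int N)"
    using a by (intro cong_diff cong_mult cong_refl)
  finally have "(- a * ((y - a * x) mod int N)) mod int N = (x - a * y) mod int N"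
    unfolding cong_def mod_mult_right_eq mult_1 .
  moreover have "(- a * ((y - a * x) mod int N)) mod int N \<in> S"
    using xy S by blast
  ultimately show ?thesis by simp
qed

text \<open>A simple graph on a fixed vertex set is determined by its adjacency relation, so the
  second conjunct concerns exactly the graph that the first provides.\<close>

theorem theorem2p16:
  fixes N :: nat and a :: int and S :: "int set" and f :: "int \<Rightarrow> int \<Rightarrow> nat"
  assumes "N > 0"
    and "a \<in> ZMod N" and "coprime a (int N)" and "[a\<^sup>2 = 1] (mod int N)"
    and "S \<subseteq> ZMod N" and "S \<noteq> {}"
    and "S = (\<lambda>t. (- a * t) mod int N) ` S"
    and "S \<inter> (\<lambda>z. ((1 - a) * z) mod int N) ` ZMod N = {}"
    and "\<And>x y. x \<in> ZMod N \<Longrightarrow> y \<in> ZMod N \<Longrightarrow>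
           f x y = (if (y - a * x) mod int N \<in> S then 1 else 0)"
  shows "(\<exists>G. simple_graph G \<and> verts G = ZMod N \<and> edge_indicator f G) \<and>
         (\<forall>G s. simple_graph G \<and> verts G = ZMod N \<and> edge_indicator f G \<and> s = card (edges G) \<longrightarrow>
            edge_complexity G = graph_energy G / sqrt (2 * real s))"
proof (intro conjI allI impI)
  have f1: "f x y = 1 \<longleftrightarrow> (y - a * x) mod int N \<in> S" if "x \<in> ZMod N" "y \<in> ZMod N" for x y
    using assms(9)[OF that] by simp
  have sym: "f x y = 1 \<longleftrightarrow> f y x = 1" if "x \<in> ZMod N" "y \<in> ZMod N" for x y
    using affine_reflection_symmetric[OF assms(4,7)] f1 that by blast
  \<comment> \<open>A loop at \<open>x\<close> would put \<open>(1 - a) * x\<close> into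
    \<open>S\<close>, which the disjointness hypothesis excludes.\<close>
  have irrefl: "f x x \<noteq> 1" if "x \<in> ZMod N" for x
  proof -
    have "(x - a * x) mod int N = ((1 - a) * x) mod int N" by (simp add: algebra_simps)
    then show ?thesis using f1[OF that that] assms(8) that by auto
  qed
  define G where "G = (ZMod N, {{x, y} |x y. x \<in> ZMod N \<and> y \<in> ZMod N \<and> f x y = 1})"
  have "simple_graph G"
    using irrefl by (fastforce simp: simple_graph_def G_def ZMod_def)
  \<comment> \<open>An edge may have been listed with its ends in the opposite order, so
    \<open>sym\<close> is needed.\<close>
  moreover have "edge_indicator f G"
    using sym by (auto simp: edge_indicator_def adjacent_def G_def doubleton_eq_iff)
  moreover have "verts G = ZMod N" by (simp add: G_def)
  ultimately show "\<exists>G. simple_graph G \<and> verts G = ZMod N \<and> edge_indicator f G" by blast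
next
  fix G :: "int graph" and s :: nat
  assume "simple_graph G \<and> verts G = ZMod N \<and> edge_indicator f G \<and> s = card (edges G)"
  then have G: "simple_graph G" and V: "verts G = ZMod N" and E: "edge_indicator f G"
    and s: "s = card (edges G)" by auto
  have cardZ: "card (ZMod N) = N" by (simp add: ZMod_def)
  then have card: "card (verts G) = N" by (simp add: V)
  \<comment> \<open>The identity labeling is the minimizer; it is restricted because labelings are
    extensional.\<close>
  define \<sigma> :: "int \<Rightarrow> int" where "\<sigma> = restrict id (ZMod N)"
  have \<sigma>: "\<sigma> \<in> labelings G"
    by (simp add: labelings_def V cardZ \<sigma>_def bij_betw_id)
  have inv: "inv_into (ZMod N) \<sigma> z = z" if "z \<in> ZMod N" for z
    using that by (intro inv_into_f_eq) (auto simp: \<sigma>_def inj_on_def)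
  have A: "adj_mat G \<sigma> $$ (x, y) = (if (int y - a * int x) mod int N \<in> S then 1 else 0)"
    if "x < N" "y < N" for x y
  proof -
    have mem: "int x \<in> ZMod N" "int y \<in> ZMod N" using that by (auto simp: ZMod_def)
    then have "adjacent G (int x) (int y) \<longleftrightarrow> (int y - a * int x) mod int N \<in> S"
      using E V assms(9)[OF mem] by (simp add: edge_indicator_def)
    then show ?thesis using that mem by (simp add: adj_mat_def V cardZ inv)
  qed
  \<comment> \<open>In column \<open>n\<close> the row that may carry a nonzero entry is the
    solution \<open>m\<close> of \<open>m + a * n = 0\<close> modulo \<open>N\<close>; it is unique
    and runs over all rows since \<open>a\<close> is a unit.\<close>
  define p where "p n = nat ((- a * int n) mod int N)" for n
  have p: "bij_betw p {..<N} {..<N}"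
    unfolding p_def using bij_betw_mult_mod[OF assms(1), of "- a"] assms(3) by simp
  have "monomial_mat p (fourier_mat N * adj_mat G \<sigma> * fourier_mat N)"
    unfolding monomial_mat_def
  proof (intro allI impI)
    fix m n assume "m < dim_row (fourier_mat N * adj_mat G \<sigma> * fourier_mat N)"
      "n < dim_col (fourier_mat N * adj_mat G \<sigma> * fourier_mat N)" and ne: "m \<noteq> p n"
    then have mn: "m < N" "n < N" by (simp_all add: fourier_mat_def)
    have "\<not> int N dvd int m + a * int n"
    proof
      assume "int N dvd int m + a * int n"
      then have "int m mod int N = (- a * int n) mod int N"
        by (simp add: mod_eq_dvd_iff)
      then show False using ne mn by (simp add: p_def)
    qed
    \<comment> \<open>By \<open>A\<close> the role of \<open>h\<close> is played by the indicator of
      \<open>S\<close>.\<close>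
    then show "(fourier_mat N * adj_mat G \<sigma> * fourier_mat N) $$ (m, n) = 0"
      using fourier_affine_eq_0[OF assms(1) _ A mn] adj_mat_carrier[of G \<sigma>] card by simp
  qed
  then show "edge_complexity G = graph_energy G / sqrt (2 * real s)"
    using edge_complexity_eq_energy[OF G \<sigma>, of p] p by (simp add: card s)
qed

end
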